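(* Consider the data model $y_i=\theta_{0,i}+\epsilon_i$, $i=1,\ldots,n$, with i.i.d. Gaussian errors $\epsilon_i\sim N(0,\sigma^2)$, and with $\theta_0\in\mathrm{BD}_G(s)$, where $G$ is a tree on $V=\{1,\ldots,n\}$. Then there are absolute constants $N,C>0$ such that for $n/s>N$, $$\inf_{\hat\theta}\ \sup_{\theta_0\in\mathrm{BD}_G(s)}\ \mathbb{E}\|\hat\theta-\theta_0\|_n^2\ \ge\ C\sigma^2\,\frac{s}{n}\log\Big(\frac{n}{s}\Big),$$ where the infimum is over all estimators $\hat\theta$ based on $y$.
   Context: For a graph $G=(V,E)$ with each edge $e$ arbitrarily oriented with endpoints $e^+,e^-$, $\|\nabla_G\theta\|_0=\sum_{e\in E}1\{\theta_{e^+}\ne\theta_{e^-}\}$, and for a sparsity parameter $s>0$, $\mathrm{BD}_G(s)=\{\theta\in\mathbb{R}^n:\|\nabla_G\theta\|_0\le s\}$. $\|x\|_n^2=\|x\|_2^2/n$.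
   Formalization: The sparsity parameter is required to satisfy s ≥ 2 rather than s > 0; for 0 < s < 1 the class contains only constant vectors and for 1 ≤ s < 2 on a path the minimax risk is of order σ² log log n / n, so the stated bound fails there. *)

theory Defs
  imports "HOL-Probability.Probability"
begin

text \<open>
  Finite simple undirected graphs are given by a vertex set and a set of two-element edges.
  The \<open>tree\<close> of the AFP entry \<open>Graph_Theory\<close> is not suitable here: it only excludes
  directed cycles, so a transitively oriented triangle would be a tree in that sense.
\<close>

definition simple_graph :: "'v set \<Rightarrow> 'v set set \<Rightarrow> bool" where
  "simple_graph V E \<longleftrightarrow> finite V \<and> (\<forall>e\<in>E. e \<subseteq> V \<and> card e = 2)"

definition graph_walk :: "'v set set \<Rightarrow> 'v list \<Rightarrow> bool" where
  "graph_walk E p \<longleftrightarrow> p \<noteq> [] \<and> (\<forall>i. Suc i < length p \<longrightarrow> {p ! i, p ! Suc i} \<in> E)"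

definition graph_connected :: "'v set \<Rightarrow> 'v set set \<Rightarrow> bool" where
  "graph_connected V E \<longleftrightarrow>
     V \<noteq> {} \<and> (\<forall>u\<in>V. \<forall>v\<in>V. \<exists>p. graph_walk E p \<and> hd p = u \<and> last p = v)"

definition graph_cycle :: "'v set set \<Rightarrow> 'v list \<Rightarrow> bool" where
  "graph_cycle E p \<longleftrightarrow>
     3 \<le> length p \<and> distinct p \<and> graph_walk E p \<and> {last p, hd p} \<in> E"

definition is_tree :: "'v set \<Rightarrow> 'v set set \<Rightarrow> bool" where
  "is_tree V E \<longleftrightarrow>
     simple_graph V E \<and> graph_connected V E \<and> (\<nexists>p. graph_cycle E p)"

text \<open>\<open>ep e\<close> and \<open>em e\<close> are the endpoints $e^+$ and $e^-$ of an oriented edge.\<close>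

definition orientation :: "'v set set \<Rightarrow> ('v set \<Rightarrow> 'v) \<Rightarrow> ('v set \<Rightarrow> 'v) \<Rightarrow> bool" where
  "orientation E ep em \<longleftrightarrow> (\<forall>e\<in>E. e = {ep e, em e})"

definition grad_l0 ::
  "'v set set \<Rightarrow> ('v set \<Rightarrow> 'v) \<Rightarrow> ('v set \<Rightarrow> 'v) \<Rightarrow> ('v \<Rightarrow> real) \<Rightarrow> real" where
  "grad_l0 E ep em \<theta> = (\<Sum>e\<in>E. of_bool (\<theta> (ep e) \<noteq> \<theta> (em e)))"

text \<open>
  Since \<open>n\<close> varies inside the statement, \<open>\<real>\<^sup>n\<close> is the set of extensional functions
  on \<open>{1..n}\<close>, which is also the space of \<open>Pi\<^sub>M {1..n} (\<lambda>_. borel)\<close>.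
\<close>

definition BD ::
  "nat \<Rightarrow> nat set set \<Rightarrow> (nat set \<Rightarrow> nat) \<Rightarrow> (nat set \<Rightarrow> nat) \<Rightarrow> real \<Rightarrow> (nat \<Rightarrow> real) set" where
  "BD n E ep em s = {\<theta> \<in> {1..n} \<rightarrow>\<^sub>E UNIV. grad_l0 E ep em \<theta> \<le> s}"

definition norm_n_sq :: "nat \<Rightarrow> (nat \<Rightarrow> real) \<Rightarrow> real" where
  "norm_n_sq n x = (\<Sum>i=1..n. (x i)\<^sup>2) / real n"

definition gauss_noise :: "nat \<Rightarrow> real \<Rightarrow> (nat \<Rightarrow> real) measure" where
  "gauss_noise n \<sigma> = Pi\<^sub>M {1..n} (\<lambda>_. density lborel (\<lambda>x. ennreal (normal_density 0 \<sigma> x)))"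

definition observation :: "nat \<Rightarrow> (nat \<Rightarrow> real) \<Rightarrow> (nat \<Rightarrow> real) \<Rightarrow> (nat \<Rightarrow> real)" where
  "observation n \<theta> \<epsilon> = (\<lambda>i\<in>{1..n}. \<theta> i + \<epsilon> i)"

definition estimators :: "nat \<Rightarrow> ((nat \<Rightarrow> real) \<Rightarrow> (nat \<Rightarrow> real)) set" where
  "estimators n = measurable (Pi\<^sub>M {1..n} (\<lambda>_. borel)) (Pi\<^sub>M {1..n} (\<lambda>_. borel))"

text \<open>
  Expected losses are taken in \<open>ennreal\<close>, so that an estimator whose loss is not integrable
  has risk \<open>\<infinity>\<close> (rather than 0, as the Bochner integral would give).
\<close>

definition risk ::
  "nat \<Rightarrow> real \<Rightarrow> ((nat \<Rightarrow> real) \<Rightarrow> (nat \<Rightarrow> real)) \<Rightarrow> (nat \<Rightarrow> real) \<Rightarrow> ennreal" where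
  "risk n \<sigma> est \<theta>0 =
     (\<integral>\<^sup>+ \<epsilon>. ennreal (norm_n_sq n (\<lambda>i. est (observation n \<theta>0 \<epsilon>) i - \<theta>0 i)) \<partial>gauss_noise n \<sigma>)"

definition minimax_risk :: "nat \<Rightarrow> real \<Rightarrow> (nat \<Rightarrow> real) set \<Rightarrow> ennreal" where
  "minimax_risk n \<sigma> \<Theta> = (INF est\<in>estimators n. SUP \<theta>0\<in>\<Theta>. risk n \<sigma> est \<theta>0)"

end

theory Submission
  imports Defs
begin

text \<open>
  A forest on \<open>n\<close> vertices has at most \<open>n\<close> edges, so at least a third of its vertices have degree
  at most 2. A vector equal to \<open>a\<close> on \<open>k = \<lfloor>s/2\<rfloor>\<close> of these \<open>m\<close> vertices and 0 elsewhere therefore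
  lies in the class, and it suffices to bound the average risk over all such supports \<open>T\<close>.
  For \<open>i \<in> T\<close>, \<open>j \<notin> T\<close> let \<open>T' = T - {i} \<union> {j}\<close>. On the event \<open>y\<^sub>i \<le> a\<close>, \<open>y\<^sub>j \<ge> 0\<close>, whose probability
  under \<open>T\<close> is at least 1/4, the likelihood ratio of \<open>T'\<close> against \<open>T\<close> is at least \<open>exp (- a\<^sup>2/\<sigma>\<^sup>2)\<close>.
  If this is at least \<open>k/(m - k)\<close>, the loss of coordinate \<open>i\<close> under \<open>T\<close>, plus \<open>(m - k)/k\<close> times that
  under \<open>T'\<close>, is at least \<open>a\<^sup>2/8\<close> in expectation. Double counting the exchanges \<open>(T, i, j)\<close> turns this
  into the bound \<open>k a\<^sup>2/8\<close> for the average total loss, and \<open>a\<^sup>2\<close> may be taken of order \<open>\<sigma>\<^sup>2 ln (n/s)\<close>.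
\<close>

subsection \<open>Forests\<close>

lemma graph_walk_Cons:
  "graph_walk E p \<Longrightarrow> {w, hd p} \<in> E \<Longrightarrow> graph_walk E (w # p)"
  unfolding graph_walk_def by (auto simp: nth_Cons hd_conv_nth split: nat.splits)

lemma graph_walk_take:
  "graph_walk E p \<Longrightarrow> 0 < k \<Longrightarrow> graph_walk E (take k p)"
  unfolding graph_walk_def by auto

text \<open>The first vertex of a longest path has all its neighbours on the path, and a neighbour
  other than the second vertex would close a cycle.\<close>
lemma acyclic_low_degree_vertex:
  assumes "simple_graph V E" "V \<noteq> {}" "\<nexists>p. graph_cycle E p"
  obtains v where "v \<in> V" "card {e\<in>E. v \<in> e} \<le> 1"
proof -
  have V: "finite V" and E: "\<And>e. e \<in> E \<Longrightarrow> e \<subseteq> V \<and> card e = 2"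
    using assms(1) by (auto simp: simple_graph_def)
  define path where "path p \<longleftrightarrow> distinct p \<and> graph_walk E p \<and> set p \<subseteq> V" for p
  from assms(2) obtain v0 where "v0 \<in> V" by auto
  then have "path [v0]"
    by (simp add: path_def graph_walk_def)
  moreover have "length p < Suc (card V)" if "path p" for p
    using that V by (metis path_def distinct_card card_mono less_Suc_eq_le)
  ultimately obtain p where p: "path p" and max: "\<And>q. path q \<Longrightarrow> length q \<le> length p"
    using ex_has_greatest_nat[of path _ length "Suc (card V)"] by (metis less_imp_le)
  from p have ne: "p \<noteq> []" and dist: "distinct p" and walk: "graph_walk E p" and sub: "set p \<subseteq> V"
    by (auto simp: path_def graph_walk_def)
  have only: "e = {hd p, p ! 1}" if e: "e \<in> E" "hd p \<in> e" for e
  proof -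
    obtain w where w: "e = {w, hd p}" "w \<noteq> hd p"
      using E[OF e(1)] e(2) by (auto simp: card_2_iff)
    have "w \<in> set p"
    proof (rule ccontr)
      assume "w \<notin> set p"
      then have "path (w # p)"
        using w e(1) E[OF e(1)] dist walk sub by (auto simp: path_def intro!: graph_walk_Cons)
      from max[OF this] show False by simp
    qed
    then obtain i where i: "i < length p" "p ! i = w"
      by (auto simp: in_set_conv_nth)
    have "i \<noteq> 0"
      using w(2) i ne by (metis hd_conv_nth)
    moreover have "i \<le> 1"
    proof (rule ccontr)
      assume "\<not> i \<le> 1"
      \<comment> \<open>The edge \<open>e\<close> closes the segment of the path from
        \<open>hd p\<close> to \<open>w\<close>; \<open>2 \<le> i\<close> gives this segment the
        three vertices a cycle requires.\<close>
      then have "graph_cycle E (take (Suc i) p)"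
        using i w e(1) dist walk ne
        by (auto simp: graph_cycle_def last_conv_nth graph_walk_take)
      with assms(3) show False by blast
    qed
    ultimately show ?thesis
      using i w by (auto simp: le_Suc_eq)
  qed
  then have "{e\<in>E. hd p \<in> e} \<subseteq> {{hd p, p ! 1}}" by auto
  from card_mono[OF _ this] have "card {e\<in>E. hd p \<in> e} \<le> 1" by simp
  moreover have "hd p \<in> V"
    using sub ne by auto
  ultimately show thesis using that by blast
qed

lemma simple_graph_finite_edges: "simple_graph V E \<Longrightarrow> finite E"
  unfolding simple_graph_def by (meson Sup_least Union_Pow_eq finite_Pow_iff finite_subset PowI subsetI)

text \<open>Induction on the number of vertices: deleting a vertex of degree at most one loses at
  most one edge and creates no cycle.\<close>

lemma acyclic_card_edges_le:
  assumes "simple_graph V E" "\<nexists>p. graph_cycle E p"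
  shows "card E \<le> card V"
  using assms
proof (induction "card V" arbitrary: V E)
  case 0
  then have "E = {}" by (auto simp: simple_graph_def)
  then show ?case by simp
next
  case (Suc k)
  then have "V \<noteq> {}" "finite V" by (auto simp: simple_graph_def)
  then obtain v where v: "v \<in> V" "card {e\<in>E. v \<in> e} \<le> 1"
    using acyclic_low_degree_vertex Suc.prems by metis
  define E' where "E' = {e\<in>E. v \<notin> e}"
  have "simple_graph (V - {v}) E'"
    using Suc.prems(1) by (auto simp: simple_graph_def E'_def)
  moreover have "\<nexists>p. graph_cycle E' p"
    using Suc.prems(2) by (auto simp: graph_cycle_def graph_walk_def E'_def)
  moreover have "k = card (V - {v})"
    using Suc.hyps(2) v(1) \<open>finite V\<close> by simp
  ultimately have "card E' \<le> k"
    using Suc.hyps(1) by blast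
  moreover have "E = E' \<union> {e\<in>E. v \<in> e}"
    by (auto simp: E'_def)
  ultimately show ?case
    using v(2) Suc.hyps(2) card_Un_le[of E' "{e\<in>E. v \<in> e}"] by simp
qed

text \<open>The handshake identity: the incidences of vertices and edges are counted by edges, each
  of which has exactly two vertices.\<close>

lemma sum_degrees:
  assumes "simple_graph V E"
  shows "(\<Sum>v\<in>V. card {e\<in>E. v \<in> e}) = 2 * card E"
proof -
  have "finite V" "finite E"
    using assms simple_graph_finite_edges by (auto simp: simple_graph_def)
  moreover have "card {v\<in>V. v \<in> e} = 2" if "e \<in> E" for e
  proof -
    have "{v\<in>V. v \<in> e} = e" using assms that by (auto simp: simple_graph_def)
    then show ?thesis using assms that by (auto simp: simple_graph_def)
  qed
  ultimately show ?thesis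
    by (subst sum_multicount[where k = 2 and T = E]) (auto simp: mult.commute)
qed

text \<open>The degrees sum to at most \<open>2 * card V\<close>, and every vertex of larger degree
  contributes at least 3, so such vertices make up at most two thirds of \<open>V\<close>.\<close>

lemma acyclic_many_low_degree:
  assumes "simple_graph V E" "\<nexists>p. graph_cycle E p"
  shows "card V \<le> 3 * card {v\<in>V. card {e\<in>E. v \<in> e} \<le> 2}"
proof -
  let ?S = "{v\<in>V. card {e\<in>E. v \<in> e} \<le> 2}"
  have V: "finite V" using assms by (simp add: simple_graph_def)
  have "3 * card (V - ?S) = (\<Sum>v\<in>V - ?S. 3)" by simp
  also have "\<dots> \<le> (\<Sum>v\<in>V - ?S. card {e\<in>E. v \<in> e})"
    by (intro sum_mono) auto
  also have "\<dots> \<le> (\<Sum>v\<in>V. card {e\<in>E. v \<in> e})"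
    using V by (intro sum_mono2) auto
  also have "\<dots> \<le> 2 * card V"
    using sum_degrees acyclic_card_edges_le assms by fastforce
  finally have "3 * card (V - ?S) \<le> 2 * card V" .
  moreover have "card (V - ?S) = card V - card ?S" "card ?S \<le> card V"
    using V by (auto intro!: card_Diff_subset card_mono)
  ultimately show ?thesis by simp
qed

text \<open>An edge along which \<open>\<theta>\<close> changes must meet \<open>T\<close>, and each
  vertex of \<open>T\<close> accounts for at most \<open>d\<close> edges.\<close>

lemma grad_l0_sparse:
  assumes "simple_graph V E" "orientation E ep em" "finite T"
    and "\<And>v. v \<in> T \<Longrightarrow> card {e\<in>E. v \<in> e} \<le> d"
    and "\<And>v. v \<in> V - T \<Longrightarrow> \<theta> v = 0"
  shows "grad_l0 E ep em \<theta> \<le> real (d * card T)"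
proof -
  have fin: "finite E" using assms(1) by (rule simple_graph_finite_edges)
  have "grad_l0 E ep em \<theta> = real (card {e\<in>E. \<theta> (ep e) \<noteq> \<theta> (em e)})"
    using fin by (simp add: grad_l0_def of_bool_def sum.If_cases Int_def)
  also have "card {e\<in>E. \<theta> (ep e) \<noteq> \<theta> (em e)} \<le> card (\<Union>v\<in>T. {e\<in>E. v \<in> e})"
  proof (intro card_mono subsetI)
    fix e assume "e \<in> {e\<in>E. \<theta> (ep e) \<noteq> \<theta> (em e)}"
    then have e: "e \<in> E" "\<theta> (ep e) \<noteq> \<theta> (em e)" by auto
    have "ep e \<in> e" "em e \<in> e" "e \<subseteq> V"
      using assms(1,2) e(1) by (auto simp: orientation_def simple_graph_def)
    moreover have "ep e \<in> T \<or> em e \<in> T"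
      using assms(5) e(2) calculation by (metis DiffI subsetD)
    ultimately show "e \<in> (\<Union>v\<in>T. {e\<in>E. v \<in> e})" using e(1) by blast
  qed (use fin assms(3) in auto)
  also have "\<dots> \<le> (\<Sum>v\<in>T. card {e\<in>E. v \<in> e})"
    using assms(3) by (rule card_UN_le)
  also have "\<dots> \<le> d * card T"
    using sum_bounded_above[of T "\<lambda>v. card {e\<in>E. v \<in> e}" d] assms(4) by (simp add: mult.commute)
  finally show ?thesis by simp
qed

subsection \<open>Averaging over supports\<close>

text \<open>The exchange \<open>T \<mapsto> T - {i} \<union> {j}\<close> turns triples with \<open>i \<in> T\<close>, \<open>j \<notin> T\<close> into triples
  with \<open>j \<in> T\<close>, \<open>i \<notin> T\<close>, bijectively.\<close>
lemma exchange_average: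
  fixes A D :: "'a set \<Rightarrow> 'a \<Rightarrow> ennreal"
  assumes S: "finite S" and k: "k < card S"
    and c: "\<And>T i j. T \<subseteq> S \<Longrightarrow> card T = k \<Longrightarrow> i \<in> T \<Longrightarrow> j \<in> S - T \<Longrightarrow>
       c \<le> A T i + ennreal (real (card S - k) / real k) * D (insert j (T - {i})) i"
    and X: "\<And>T. T \<subseteq> S \<Longrightarrow> card T = k \<Longrightarrow> (\<Sum>i\<in>T. A T i) + (\<Sum>i\<in>S - T. D T i) \<le> X"
  shows "of_nat k * c \<le> X"
proof (cases "k = 0")
  case False
  define F where "F = {T. T \<subseteq> S \<and> card T = k}"
  define q where "q = card S - k"
  define R where "R = ennreal (real q / real k)"
  have F: "finite F" "finite T" "T \<subseteq> S" "card T = k" "card (S - T) = q" if "T \<in> F" for T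
    using that S by (auto simp: F_def q_def finite_subset card_Diff_subset)
  have finF: "finite F" using S by (simp add: F_def)
  have cardF: "card F \<noteq> 0"
    using k n_subsets[OF S, of k] by (simp add: F_def)
  \<comment> \<open>In the sums below each \<open>A T i\<close> occurs \<open>q\<close> times, once
    for every \<open>j\<close> outside \<open>T\<close>, and each \<open>D T i\<close> occurs
    \<open>k\<close> times. The weight \<open>R\<close> raises the second multiplicity to
    \<open>q\<close>, so that the two losses add up to the total bounded by
    \<open>X\<close>.\<close>
  have Rk: "R * of_nat k = of_nat q"
    using False by (simp add: R_def ennreal_of_nat_eq_real_of_nat flip: ennreal_mult')
  \<comment> \<open>\<open>P\<close> holds the triples before an exchange, with \<open>i\<close>
    inside and \<open>j\<close> outside; \<open>P'\<close> those after it, with \<open>i\<close>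
    outside and \<open>j\<close> inside. The exchange changes the set and keeps the pair, so the
    inverse map swaps the roles of \<open>i\<close> and \<open>j\<close>.\<close>
  define P where "P = (SIGMA T:F. T \<times> (S - T))"
  define P' where "P' = (SIGMA T:F. (S - T) \<times> T)"
  have sum_A: "(\<Sum>(T,i,j)\<in>P. A T i) = of_nat q * (\<Sum>T\<in>F. \<Sum>i\<in>T. A T i)"
    unfolding P_def using F finF S
    by (simp add: sum.Sigma[symmetric] sum.cartesian_product[symmetric] sum_distrib_left)
  have sum_D': "(\<Sum>(T,i,j)\<in>P'. D T i) = of_nat k * (\<Sum>T\<in>F. \<Sum>i\<in>S - T. D T i)"
    unfolding P'_def using F finF S
    by (simp add: sum.Sigma[symmetric] sum.cartesian_product[symmetric] sum_distrib_left)
  have sum_D: "(\<Sum>(T,i,j)\<in>P. D (insert j (T - {i})) i) = (\<Sum>(T,i,j)\<in>P'. D T i)"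
  proof (rule sum.reindex_bij_witness[where i = "\<lambda>(T,i,j). (insert i (T - {j}), i, j)"
        and j = "\<lambda>(T,i,j). (insert j (T - {i}), i, j)"])
    fix x assume "x \<in> P"
    then obtain T i j where x: "x = (T,i,j)" and T: "T \<in> F" "i \<in> T" "j \<in> S" "j \<notin> T"
      by (auto simp: P_def)
    have "card (insert j (T - {i})) = k"
      using F[OF T(1)] T False by (simp add: card_Diff_singleton)
    moreover have "insert j (T - {i}) \<subseteq> S" using F[OF T(1)] T by auto
    ultimately have "insert j (T - {i}) \<in> F" by (simp add: F_def)
    moreover have "i \<in> S" "i \<noteq> j" using F[OF T(1)] T by auto
    ultimately show "(\<lambda>(T,i,j). (insert j (T - {i}), i, j)) x \<in> P'"
      by (auto simp: x P'_def)
    show "(\<lambda>(T,i,j). (insert i (T - {j}), i, j)) ((\<lambda>(T,i,j). (insert j (T - {i}), i, j)) x) = x"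
      using T by (auto simp: x)
  next
    fix x assume "x \<in> P'"
    then obtain T i j where x: "x = (T,i,j)" and T: "T \<in> F" "j \<in> T" "i \<in> S" "i \<notin> T"
      by (auto simp: P'_def)
    have "card (insert i (T - {j})) = k"
      using F[OF T(1)] T False by (simp add: card_Diff_singleton)
    moreover have "insert i (T - {j}) \<subseteq> S" using F[OF T(1)] T by auto
    ultimately have "insert i (T - {j}) \<in> F" by (simp add: F_def)
    moreover have "j \<in> S" "i \<noteq> j" using F[OF T(1)] T by auto
    ultimately show "(\<lambda>(T,i,j). (insert i (T - {j}), i, j)) x \<in> P"
      by (auto simp: x P_def)
    show "(\<lambda>(T,i,j). (insert j (T - {i}), i, j)) ((\<lambda>(T,i,j). (insert i (T - {j}), i, j)) x) = x"
      using T by (auto simp: x)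
  qed auto
  have "card P = card F * (k * q)"
    unfolding P_def using F finF S by (subst card_SigmaI) (auto simp: card_cartesian_product)
  then have "of_nat (card F * (k * q)) * c = (\<Sum>x\<in>P. c)"
    by simp
  also have "\<dots> \<le> (\<Sum>(T,i,j)\<in>P. A T i + R * D (insert j (T - {i})) i)"
    using c by (intro sum_mono) (auto simp: P_def F_def R_def q_def)
  also have "\<dots> = (\<Sum>(T,i,j)\<in>P. A T i) + R * (\<Sum>(T,i,j)\<in>P. D (insert j (T - {i})) i)"
    by (simp add: case_prod_unfold sum.distrib sum_distrib_left)
  also have "\<dots> = of_nat q * (\<Sum>T\<in>F. (\<Sum>i\<in>T. A T i) + (\<Sum>i\<in>S - T. D T i))"
    unfolding sum_A sum_D sum_D'
    by (simp add: mult.assoc[symmetric] Rk sum.distrib distrib_left)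
  also have "\<dots> \<le> of_nat q * (\<Sum>T\<in>F. X)"
    using X by (intro mult_left_mono sum_mono) (auto simp: F_def)
  finally have "of_nat (card F * q) * (of_nat k * c) \<le> of_nat (card F * q) * X"
    by (simp add: mult_ac)
  \<comment> \<open>Cancellation in \<open>ennreal\<close> requires a nonzero finite factor; both
    numbers are positive because \<open>k < card S\<close>.\<close>
  moreover have "card F * q \<noteq> 0"
    using k cardF by (simp add: q_def)
  ultimately show ?thesis
    by (metis ennreal_mult_le_mult_iff ennreal_of_nat_neq_top of_nat_eq_0_iff)
qed simp

subsection \<open>Gaussian product measures\<close>

text \<open>The law of the data when the mean vector is \<open>\<theta>\<close>.\<close>

definition gauss_prod :: "'i set \<Rightarrow> real \<Rightarrow> ('i \<Rightarrow> real) \<Rightarrow> ('i \<Rightarrow> real) measure" where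
  "gauss_prod I \<sigma> \<theta> = Pi\<^sub>M I (\<lambda>i. density lborel (\<lambda>x. ennreal (normal_density (\<theta> i) \<sigma> x)))"

lemma sets_gauss_prod [measurable_cong]:
  "sets (gauss_prod I \<sigma> \<theta>) = sets (Pi\<^sub>M I (\<lambda>_. borel))"
  unfolding gauss_prod_def by (intro sets_PiM_cong) auto

lemma product_prob_space_normal:
  "0 < \<sigma> \<Longrightarrow> product_prob_space (\<lambda>i. density lborel (\<lambda>x. ennreal (normal_density (\<theta> i) \<sigma> x)))"
  by (intro product_prob_spaceI prob_space_normal_density)

lemma emeasure_gauss_prod:
  assumes "0 < \<sigma>" "finite I" "\<And>i. i \<in> I \<Longrightarrow> A i \<in> sets borel"
  shows "emeasure (gauss_prod I \<sigma> \<theta>) (Pi\<^sub>E I A) =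
    (\<Prod>i\<in>I. emeasure (density lborel (\<lambda>x. ennreal (normal_density (\<theta> i) \<sigma> x))) (A i))"
proof -
  interpret product_prob_space "\<lambda>i. density lborel (\<lambda>x. ennreal (normal_density (\<theta> i) \<sigma> x))"
    using assms(1) by (rule product_prob_space_normal)
  show ?thesis
    unfolding gauss_prod_def using assms by (intro emeasure_PiM) auto
qed

text \<open>Measurable boxes determine a finite product measure. This serves to identify both the
  law of the shifted noise and the measure given by the joint density.\<close>

lemma gauss_prod_eqI:
  assumes "0 < \<sigma>" "finite I" and sets_M: "sets M = sets (Pi\<^sub>M I (\<lambda>_. borel))"
    and "\<And>A. (\<And>i. i \<in> I \<Longrightarrow> A i \<in> sets borel) \<Longrightarrow> emeasure M (Pi\<^sub>E I A) =
      (\<Prod>i\<in>I. emeasure (density lborel (\<lambda>x. ennreal (normal_density (\<theta> i) \<sigma> x))) (A i))"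
  shows "M = gauss_prod I \<sigma> \<theta>"
proof -
  interpret product_prob_space "\<lambda>i. density lborel (\<lambda>x. ennreal (normal_density (\<theta> i) \<sigma> x))"
    using assms(1) by (rule product_prob_space_normal)
  have "sets M = sets (gauss_prod I \<sigma> \<theta>)"
    by (simp add: sets_M sets_gauss_prod)
  then show ?thesis
    unfolding gauss_prod_def using assms(2,4) by (intro PiM_eqI) auto
qed

lemma distr_normal_shift:
  assumes "0 < \<sigma>"
  shows "distr (density lborel (\<lambda>x. ennreal (normal_density 0 \<sigma> x))) borel (\<lambda>x. t + x)
    = density lborel (\<lambda>x. ennreal (normal_density t \<sigma> x))"
proof -
  interpret prob_space "density lborel (\<lambda>x. ennreal (normal_density 0 \<sigma> x))"
    using assms by (rule prob_space_normal_density)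
  \<comment> \<open>The rule for affine images speaks of normal random variables; the identity on
    the normal law is one, and it is used with slope 1 and intercept \<open>t\<close>.\<close>
  have "distributed (density lborel (\<lambda>x. ennreal (normal_density 0 \<sigma> x))) lborel (\<lambda>x. x) (normal_density 0 \<sigma>)"
    by (auto simp: distributed_def distr_id2 sets_eq_imp_space_eq)
  from normal_density_affine[OF this assms, of 1 t] 
  have "distr (density lborel (\<lambda>x. ennreal (normal_density 0 \<sigma> x))) lborel (\<lambda>x. t + x)
    = density lborel (\<lambda>x. ennreal (normal_density t \<sigma> x))"
    by (simp add: distributed_def)
  then show ?thesis by (metis distr_cong sets_lborel)
qed

lemma observation_measurable [measurable]:
  "observation n \<theta> \<in> measurable (Pi\<^sub>M {1..n} (\<lambda>_. borel)) (Pi\<^sub>M {1..n} (\<lambda>_. borel))"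
  unfolding observation_def by measurable

text \<open>The preimage of a box under a coordinatewise shift is a box, so its probability
  factorises and each factor is a shifted normal probability. Integrals over the noise thereby
  become integrals over the data.\<close>

lemma distr_observation:
  assumes "0 < \<sigma>"
  shows "distr (gauss_noise n \<sigma>) (Pi\<^sub>M {1..n} (\<lambda>_. borel)) (observation n \<theta>) = gauss_prod {1..n} \<sigma> \<theta>"
proof (rule gauss_prod_eqI)
  fix A :: "nat \<Rightarrow> real set" assume A: "\<And>i. i \<in> {1..n} \<Longrightarrow> A i \<in> sets borel"
  have noise: "gauss_noise n \<sigma> = gauss_prod {1..n} \<sigma> (\<lambda>_. 0)"
    by (simp add: gauss_noise_def gauss_prod_def)
  have meas: "observation n \<theta> \<in> measurable (gauss_noise n \<sigma>) (Pi\<^sub>M {1..n} (\<lambda>_. borel))"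
    unfolding noise by measurable
  have "observation n \<theta> -` Pi\<^sub>E {1..n} A \<inter> space (gauss_noise n \<sigma>) =
      (\<Pi>\<^sub>E i\<in>{1..n}. (\<lambda>x. \<theta> i + x) -` A i)"
    by (auto simp: observation_def gauss_noise_def space_PiM PiE_iff)
  then have "emeasure (distr (gauss_noise n \<sigma>) (Pi\<^sub>M {1..n} (\<lambda>_. borel)) (observation n \<theta>)) (Pi\<^sub>E {1..n} A)
      = emeasure (gauss_noise n \<sigma>) (\<Pi>\<^sub>E i\<in>{1..n}. (\<lambda>x. \<theta> i + x) -` A i)"
    using A meas by (subst emeasure_distr) (auto intro!: sets_PiM_I_finite)
  also have "\<dots> = (\<Prod>i\<in>{1..n}. emeasure (density lborel (\<lambda>x. ennreal (normal_density 0 \<sigma> x))) ((\<lambda>x. \<theta> i + x) -` A i))"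
    unfolding noise
  proof (intro emeasure_gauss_prod)
    fix i assume "i \<in> {1..n}"
    then show "(\<lambda>x. \<theta> i + x) -` A i \<in> sets borel"
      using A by (intro measurable_sets_borel[of _ borel]) auto
  qed (use assms in auto)
  also have "\<dots> = (\<Prod>i\<in>{1..n}. emeasure (density lborel (\<lambda>x. ennreal (normal_density (\<theta> i) \<sigma> x))) (A i))"
  proof (intro prod.cong refl)
    fix i assume "i \<in> {1..n}"
    then show "emeasure (density lborel (\<lambda>x. ennreal (normal_density 0 \<sigma> x))) ((\<lambda>x. \<theta> i + x) -` A i)
        = emeasure (density lborel (\<lambda>x. ennreal (normal_density (\<theta> i) \<sigma> x))) (A i)"
      using A[of i] unfolding distr_normal_shift[OF assms, of "\<theta> i", symmetric]
      by (subst emeasure_distr) auto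
  qed
  finally show "emeasure (distr (gauss_noise n \<sigma>) (Pi\<^sub>M {1..n} (\<lambda>_. borel)) (observation n \<theta>)) (Pi\<^sub>E {1..n} A)
     = (\<Prod>i\<in>{1..n}. emeasure (density lborel (\<lambda>x. ennreal (normal_density (\<theta> i) \<sigma> x))) (A i))" .
qed (use assms in auto)

text \<open>Supplies a dominating measure common to all mean vectors, so that two of these laws can
  be compared pointwise through their densities. On boxes the integrand is a product and the
  integral factorises.\<close>

lemma gauss_prod_density:
  assumes "0 < \<sigma>" "finite I"
  shows "gauss_prod I \<sigma> \<theta> =
    density (Pi\<^sub>M I (\<lambda>_. lborel)) (\<lambda>y. ennreal (\<Prod>i\<in>I. normal_density (\<theta> i) \<sigma> (y i)))"
proof (rule gauss_prod_eqI[symmetric])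
  interpret product_sigma_finite "\<lambda>_::'a. lborel :: real measure" ..
  fix A :: "'a \<Rightarrow> real set" assume A: "\<And>i. i \<in> I \<Longrightarrow> A i \<in> sets borel"
  have ind: "indicator (Pi\<^sub>E I A) y = (\<Prod>i\<in>I. indicator (A i) (y i) :: ennreal)"
    if "y \<in> space (Pi\<^sub>M I (\<lambda>_. lborel))" for y
    using that assms(2) by (auto simp: space_PiM PiE_iff indicator_def prod_zero_iff intro!: prod.neutral)
  have "emeasure (density (Pi\<^sub>M I (\<lambda>_. lborel)) (\<lambda>y. ennreal (\<Prod>i\<in>I. normal_density (\<theta> i) \<sigma> (y i)))) (Pi\<^sub>E I A)
    = (\<integral>\<^sup>+y. ennreal (\<Prod>i\<in>I. normal_density (\<theta> i) \<sigma> (y i)) * indicator (Pi\<^sub>E I A) y \<partial>Pi\<^sub>M I (\<lambda>_. lborel))"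
    using assms A by (intro emeasure_density) (auto intro!: sets_PiM_I_finite)
  also have "\<dots> = (\<integral>\<^sup>+y. (\<Prod>i\<in>I. ennreal (normal_density (\<theta> i) \<sigma> (y i)) * indicator (A i) (y i)) \<partial>Pi\<^sub>M I (\<lambda>_. lborel))"
    by (intro nn_integral_cong) (simp add: ind prod.distrib prod_ennreal)
  also have "\<dots> = (\<Prod>i\<in>I. \<integral>\<^sup>+x. ennreal (normal_density (\<theta> i) \<sigma> x) * indicator (A i) x \<partial>lborel)"
    using assms(2) A by (intro product_nn_integral_prod) auto
  also have "\<dots> = (\<Prod>i\<in>I. emeasure (density lborel (\<lambda>x. ennreal (normal_density (\<theta> i) \<sigma> x))) (A i))"
    using A by (intro prod.cong refl) (simp add: emeasure_density)
  finally show "emeasure (density (Pi\<^sub>M I (\<lambda>_. lborel)) (\<lambda>y. ennreal (\<Prod>i\<in>I. normal_density (\<theta> i) \<sigma> (y i)))) (Pi\<^sub>E I A)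
    = (\<Prod>i\<in>I. emeasure (density lborel (\<lambda>x. ennreal (normal_density (\<theta> i) \<sigma> x))) (A i))" .
qed (use assms in \<open>auto intro!: sets_PiM_cong\<close>)

text \<open>The reflection of \<open>x\<close> to \<open>2*t - x\<close> preserves the density and
  exchanges the half-lines, so their probabilities agree; as they cover the line, each is at least
  one half.\<close>

lemma normal_half_lines:
  assumes "0 < \<sigma>"
  shows "emeasure (density lborel (\<lambda>x. ennreal (normal_density t \<sigma> x))) {..t} \<ge> ennreal (1/2)"
    and "emeasure (density lborel (\<lambda>x. ennreal (normal_density t \<sigma> x))) {t..} \<ge> ennreal (1/2)"
proof -
  let ?M = "density lborel (\<lambda>x. ennreal (normal_density t \<sigma> x))"
  interpret prob_space ?M
    using assms by (rule prob_space_normal_density)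
  have "emeasure ?M {..t} = (\<integral>\<^sup>+x. ennreal (normal_density t \<sigma> x) * indicator {..t} x \<partial>lborel)"
    by (simp add: emeasure_density)
  also have "\<dots> = (\<integral>\<^sup>+x. ennreal (normal_density t \<sigma> (2*t + -1 * x)) * indicator {..t} (2*t + -1 * x) \<partial>lborel)"
    by (subst nn_integral_real_affine[where c = "-1" and t = "2*t"]) auto
  also have "\<dots> = (\<integral>\<^sup>+x. ennreal (normal_density t \<sigma> x) * indicator {t..} x \<partial>lborel)"
    by (intro nn_integral_cong) (auto simp: normal_density_def indicator_def power2_commute)
  also have "\<dots> = emeasure ?M {t..}"
    by (simp add: emeasure_density)
  finally have eq: "prob {..t} = prob {t..}"
    by (simp add: emeasure_eq_measure)
  have "{..t} \<union> {t..} = UNIV" by auto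
  then have "1 = prob ({..t} \<union> {t..})"
    using prob_space by simp
  also have "\<dots> \<le> prob {..t} + prob {t..}"
    by (intro measure_Un_le) auto
  finally have "1/2 \<le> prob {..t}" "1/2 \<le> prob {t..}"
    using eq by auto
  then show "ennreal (1/2) \<le> emeasure ?M {..t}" "ennreal (1/2) \<le> emeasure ?M {t..}"
    unfolding emeasure_eq_measure by (auto simp only: ennreal_leI)
qed

text \<open>On the event \<open>A\<close> the density for \<open>\<theta>\<close> is at most
  \<open>R\<close> times that for \<open>\<theta>'\<close>. Hence both losses can be integrated
  against the former, where no value of \<open>f\<close> is close to \<open>a\<close> and to 0 at
  once: their sum is at least \<open>a\<^sup>2 / 2\<close>. The probability of \<open>A\<close>
  contributes the factor 1/4.\<close>

lemma two_point_bound: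
  assumes \<sigma>: "0 < \<sigma>" and I: "finite I" and ij: "i \<in> I" "j \<in> I" "i \<noteq> j"
    and a: "a \<ge> 0" "exp (a\<^sup>2 / \<sigma>\<^sup>2) \<le> R"
    and \<theta>: "\<theta> i = a" "\<theta> j = 0" "\<theta>' i = 0" "\<theta>' j = a" "\<And>l. l \<in> I - {i,j} \<Longrightarrow> \<theta>' l = \<theta> l"
    and f [measurable]: "f \<in> borel_measurable (Pi\<^sub>M I (\<lambda>_. borel))"
  shows "ennreal (a\<^sup>2 / 8) \<le> (\<integral>\<^sup>+y. ennreal ((f y - a)\<^sup>2) \<partial>gauss_prod I \<sigma> \<theta>)
    + ennreal R * (\<integral>\<^sup>+y. ennreal ((f y)\<^sup>2) \<partial>gauss_prod I \<sigma> \<theta>')"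
proof -
  define p where "p \<theta> y = (\<Prod>l\<in>I. normal_density (\<theta> l) \<sigma> (y l))" for \<theta> y :: "'a \<Rightarrow> real"
  define A where "A = (\<Pi>\<^sub>E l\<in>I. if l = i then {..a} else if l = j then {0..} else UNIV)"
  have p_nonneg: "0 \<le> p \<theta> y" for \<theta> y
    unfolding p_def by (intro prod_nonneg) auto
  have R: "0 < R"
    using a(2) by (smt (verit) exp_gt_zero)
  have split: "p \<theta> y = normal_density (\<theta> i) \<sigma> (y i) * normal_density (\<theta> j) \<sigma> (y j)
      * (\<Prod>l\<in>I - {i,j}. normal_density (\<theta> l) \<sigma> (y l))" for \<theta> y
  proof -
    have "p \<theta> y = (\<Prod>l\<in>insert i (insert j (I - {i,j})). normal_density (\<theta> l) \<sigma> (y l))"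
      unfolding p_def using ij by (intro prod.cong) auto
    then show ?thesis
      using ij I by (simp add: mult.assoc)
  qed
  have ratio: "p \<theta> y \<le> R * p \<theta>' y" if "y \<in> A" for y
  proof -
    have y: "y i \<le> a" "0 \<le> y j"
      using that ij by (auto simp: A_def PiE_iff split: if_splits)
    have rest: "(\<Prod>l\<in>I - {i,j}. normal_density (\<theta>' l) \<sigma> (y l)) = (\<Prod>l\<in>I - {i,j}. normal_density (\<theta> l) \<sigma> (y l))"
      using \<theta>(5) by (intro prod.cong) auto
    \<comment> \<open>The logarithm of the likelihood ratio is
      \<open>a * (y i - y j) / \<sigma>\<^sup>2\<close>; it is written as
      \<open>a\<^sup>2 / \<sigma>\<^sup>2\<close> plus a term that is nonpositive on
      \<open>A\<close>.\<close>
    have "- (y i - a)\<^sup>2 / (2 * \<sigma>\<^sup>2) + - (y j)\<^sup>2 / (2 * \<sigma>\<^sup>2)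
        = (a * (y i - a) - a * y j) / \<sigma>\<^sup>2 + (a\<^sup>2 / \<sigma>\<^sup>2 + (- (y i)\<^sup>2 / (2 * \<sigma>\<^sup>2) + - (y j - a)\<^sup>2 / (2 * \<sigma>\<^sup>2)))"
      using \<sigma> by (simp add: field_simps power2_eq_square)
    moreover have "a * (y i - a) - a * y j \<le> 0"
      using a(1) y by (smt (verit) mult_nonneg_nonneg mult_nonneg_nonpos)
    ultimately have "- (y i - a)\<^sup>2 / (2 * \<sigma>\<^sup>2) + - (y j)\<^sup>2 / (2 * \<sigma>\<^sup>2)
        \<le> a\<^sup>2 / \<sigma>\<^sup>2 + (- (y i)\<^sup>2 / (2 * \<sigma>\<^sup>2) + - (y j - a)\<^sup>2 / (2 * \<sigma>\<^sup>2))"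
      using \<sigma> by (simp add: divide_nonpos_pos)
    then have "exp (- (y i - a)\<^sup>2 / (2 * \<sigma>\<^sup>2)) * exp (- (y j)\<^sup>2 / (2 * \<sigma>\<^sup>2))
        \<le> exp (a\<^sup>2 / \<sigma>\<^sup>2) * (exp (- (y i)\<^sup>2 / (2 * \<sigma>\<^sup>2)) * exp (- (y j - a)\<^sup>2 / (2 * \<sigma>\<^sup>2)))"
      by (simp flip: exp_add)
    also have "\<dots> \<le> R * (exp (- (y i)\<^sup>2 / (2 * \<sigma>\<^sup>2)) * exp (- (y j - a)\<^sup>2 / (2 * \<sigma>\<^sup>2)))"
      using a(2) by (intro mult_right_mono) auto
    \<comment> \<open>The normalising constant enters squared, once for each of the coordinates
      \<open>i\<close> and \<open>j\<close>.\<close>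
    finally have "(1 / sqrt (2 * pi * \<sigma>\<^sup>2))\<^sup>2 * (exp (- (y i - a)\<^sup>2 / (2 * \<sigma>\<^sup>2)) * exp (- (y j)\<^sup>2 / (2 * \<sigma>\<^sup>2)))
        \<le> (1 / sqrt (2 * pi * \<sigma>\<^sup>2))\<^sup>2 * (R * (exp (- (y i)\<^sup>2 / (2 * \<sigma>\<^sup>2)) * exp (- (y j - a)\<^sup>2 / (2 * \<sigma>\<^sup>2))))"
      by (intro mult_left_mono) auto
    then have "normal_density a \<sigma> (y i) * normal_density 0 \<sigma> (y j)
        \<le> R * (normal_density 0 \<sigma> (y i) * normal_density a \<sigma> (y j))"
      by (simp add: normal_density_def power2_eq_square mult_ac)
    then show ?thesis
      unfolding split rest \<theta> mult.assoc[symmetric]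
      by (intro mult_right_mono prod_nonneg) (auto simp: mult.assoc)
  qed
  have A_sets [measurable]: "A \<in> sets (Pi\<^sub>M I (\<lambda>_. borel))"
    unfolding A_def using I by (intro sets_PiM_I_finite) auto
  have [measurable_cong]: "sets (Pi\<^sub>M I (\<lambda>_. lborel :: real measure)) = sets (Pi\<^sub>M I (\<lambda>_. borel))"
    by (intro sets_PiM_cong) auto
  have p_meas [measurable]: "p \<theta> \<in> borel_measurable (Pi\<^sub>M I (\<lambda>_. borel))" for \<theta>
    unfolding p_def by measurable
  have "ennreal (1/4) = ennreal (1/2) * ennreal (1/2)"
    by (subst ennreal_mult''[symmetric]) auto
  also have "\<dots> \<le> emeasure (density lborel (\<lambda>x. ennreal (normal_density (\<theta> i) \<sigma> x))) {..a} *
      emeasure (density lborel (\<lambda>x. ennreal (normal_density (\<theta> j) \<sigma> x))) {0..}"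
    using normal_half_lines[OF \<sigma>] \<theta> by (intro mult_mono) auto
  also have "\<dots> = emeasure (gauss_prod I \<sigma> \<theta>) A"
  proof -
    let ?m = "\<lambda>l. emeasure (density lborel (\<lambda>x. ennreal (normal_density (\<theta> l) \<sigma> x)))
         (if l = i then {..a} else if l = j then {0..} else UNIV)"
    \<comment> \<open>The other coordinates are unconstrained in \<open>A\<close>, so only the two
      half-line probabilities remain.\<close>
    have "?m l = 1" if "l \<in> I - {i,j}" for l
      using that prob_space.emeasure_space_1[OF prob_space_normal_density[OF \<sigma>, of "\<theta> l"]] by auto
    then have "(\<Prod>l\<in>I - {i,j}. ?m l) = 1"
      by (intro prod.neutral) auto
    moreover have "(\<Prod>l\<in>I. ?m l) = (\<Prod>l\<in>insert i (insert j (I - {i,j})). ?m l)"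
      using ij by (intro prod.cong) auto
    moreover have "emeasure (gauss_prod I \<sigma> \<theta>) A = (\<Prod>l\<in>I. ?m l)"
      unfolding A_def by (intro emeasure_gauss_prod \<sigma> I) auto
    ultimately show ?thesis
      using ij I by (simp del: prod.insert_remove)
  qed
  finally have A_prob: "ennreal (1/4) \<le> emeasure (gauss_prod I \<sigma> \<theta>) A" .
  have "ennreal (a\<^sup>2 / 8) = ennreal (a\<^sup>2 / 2) * ennreal (1/4)"
    by (simp flip: ennreal_mult'')
  also have "\<dots> \<le> ennreal (a\<^sup>2 / 2) * emeasure (gauss_prod I \<sigma> \<theta>) A"
    by (intro mult_left_mono A_prob) auto
  also have "\<dots> = (\<integral>\<^sup>+y. ennreal (a\<^sup>2 / 2) * indicator A y \<partial>gauss_prod I \<sigma> \<theta>)"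
    by (subst nn_integral_cmult_indicator) auto
  also have "\<dots> = (\<integral>\<^sup>+y. ennreal (p \<theta> y) * (ennreal (a\<^sup>2 / 2) * indicator A y) \<partial>Pi\<^sub>M I (\<lambda>_. lborel))"
    unfolding gauss_prod_density[OF \<sigma> I] p_def[symmetric]
    by (subst nn_integral_density) auto
  also have "\<dots> \<le> (\<integral>\<^sup>+y. ennreal (p \<theta> y) * ennreal ((f y - a)\<^sup>2)
      + ennreal R * (ennreal (p \<theta>' y) * ennreal ((f y)\<^sup>2)) \<partial>Pi\<^sub>M I (\<lambda>_. lborel))"
  proof (intro nn_integral_mono)
    fix y
    show "ennreal (p \<theta> y) * (ennreal (a\<^sup>2 / 2) * indicator A y) \<le> ennreal (p \<theta> y) * ennreal ((f y - a)\<^sup>2)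
      + ennreal R * (ennreal (p \<theta>' y) * ennreal ((f y)\<^sup>2))"
    proof (cases "y \<in> A")
      case True
      \<comment> \<open>Half of this square is the amount by which
        \<open>(f y - a)\<^sup>2 + (f y)\<^sup>2\<close> exceeds its minimum
        \<open>a\<^sup>2 / 2\<close>, attained at \<open>f y = a / 2\<close>.\<close>
      have "0 \<le> (2 * f y - a)\<^sup>2" by simp
      then have "a\<^sup>2 / 2 \<le> (f y - a)\<^sup>2 + (f y)\<^sup>2"
        by (simp add: power2_eq_square algebra_simps)
      then have "p \<theta> y * (a\<^sup>2 / 2) \<le> p \<theta> y * (f y - a)\<^sup>2 + p \<theta> y * (f y)\<^sup>2"
        using p_nonneg by (metis distrib_left mult_left_mono)
      also have "p \<theta> y * (f y)\<^sup>2 \<le> R * p \<theta>' y * (f y)\<^sup>2"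
        using ratio[OF True] by (intro mult_right_mono) auto
      finally show ?thesis
        using True p_nonneg R by (simp add: mult.assoc flip: ennreal_mult' ennreal_plus)
    qed auto
  qed
  also have "\<dots> = (\<integral>\<^sup>+y. ennreal ((f y - a)\<^sup>2) \<partial>gauss_prod I \<sigma> \<theta>)
    + ennreal R * (\<integral>\<^sup>+y. ennreal ((f y)\<^sup>2) \<partial>gauss_prod I \<sigma> \<theta>')"
    unfolding gauss_prod_density[OF \<sigma> I] p_def[symmetric]
    by (simp add: nn_integral_density nn_integral_add nn_integral_cmult)
  finally show ?thesis .
qed

subsection \<open>Minimax lower bound\<close>

text \<open>The factor \<open>n\<close> clears the normalisation of the loss, which then separates
  into coordinates, each integrated under the law of the data.\<close>

lemma risk_eq_sum:
  assumes \<sigma>: "0 < \<sigma>" and n: "0 < n" and est: "est \<in> estimators n"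
  shows "of_nat n * risk n \<sigma> est \<theta> =
    (\<Sum>i=1..n. \<integral>\<^sup>+y. ennreal ((est y i - \<theta> i)\<^sup>2) \<partial>gauss_prod {1..n} \<sigma> \<theta>)"
proof -
  have [measurable]: "est \<in> measurable (Pi\<^sub>M {1..n} (\<lambda>_. borel)) (Pi\<^sub>M {1..n} (\<lambda>_. borel))"
    using est by (simp add: estimators_def)
  have [measurable]: "(\<lambda>y. est y i) \<in> borel_measurable (Pi\<^sub>M {1..n} (\<lambda>_. borel))" if "i \<in> {1..n}" for i
    using that by measurable
  have [measurable_cong]: "sets (gauss_noise n \<sigma>) = sets (Pi\<^sub>M {1..n} (\<lambda>_. borel))"
    unfolding gauss_noise_def by (intro sets_PiM_cong) auto
  have loss: "of_nat n * ennreal (norm_n_sq n x) = (\<Sum>i=1..n. ennreal ((x i)\<^sup>2))" for x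
    using n by (simp add: norm_n_sq_def sum_nonneg ennreal_of_nat_eq_real_of_nat flip: ennreal_mult')
  have [measurable]: "(\<lambda>y. norm_n_sq n (\<lambda>i. est y i - \<theta> i)) \<in> borel_measurable (Pi\<^sub>M {1..n} (\<lambda>_. borel))"
    unfolding norm_n_sq_def by measurable
  have "risk n \<sigma> est \<theta> = (\<integral>\<^sup>+y. ennreal (norm_n_sq n (\<lambda>i. est y i - \<theta> i)) \<partial>gauss_prod {1..n} \<sigma> \<theta>)"
    unfolding risk_def distr_observation[OF \<sigma>, symmetric] by (rule nn_integral_distr[symmetric]) measurable
  then have "of_nat n * risk n \<sigma> est \<theta> =
      (\<integral>\<^sup>+y. of_nat n * ennreal (norm_n_sq n (\<lambda>i. est y i - \<theta> i)) \<partial>gauss_prod {1..n} \<sigma> \<theta>)"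
    by (simp add: nn_integral_cmult del: One_nat_def)
  also have "\<dots> = (\<Sum>i=1..n. \<integral>\<^sup>+y. ennreal ((est y i - \<theta> i)\<^sup>2) \<partial>gauss_prod {1..n} \<sigma> \<theta>)"
    unfolding loss by (intro nn_integral_sum) measurable
  finally show ?thesis .
qed

lemma sparse_minimax_bound:
  assumes \<sigma>: "0 < \<sigma>" and S: "S \<subseteq> {1..n}" and k: "0 < k" "k < card S" and a: "0 \<le> a"
    and R: "exp (a\<^sup>2 / \<sigma>\<^sup>2) \<le> real (card S - k) / real k"
    and \<Theta>: "\<And>T. T \<subseteq> S \<Longrightarrow> card T = k \<Longrightarrow> (\<lambda>i\<in>{1..n}. if i \<in> T then a else 0) \<in> \<Theta>"
  shows "ennreal (real k * a\<^sup>2 / (8 * real n)) \<le> minimax_risk n \<sigma> \<Theta>"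
  unfolding minimax_risk_def
proof (intro INF_greatest)
  fix est assume est: "est \<in> estimators n"
  define X where "X = (SUP \<theta>0\<in>\<Theta>. risk n \<sigma> est \<theta>0)"
  define spike where "spike T = (\<lambda>i\<in>{1..n}. if i \<in> T then a else 0)" for T
  have n: "0 < n" using S k by (cases n) auto
  have finS: "finite S" using S finite_subset by blast
  have [measurable]: "est \<in> measurable (Pi\<^sub>M {1..n} (\<lambda>_. borel)) (Pi\<^sub>M {1..n} (\<lambda>_. borel))"
    using est by (simp add: estimators_def)
  have "of_nat k * ennreal (a\<^sup>2 / 8) \<le> of_nat n * X"
  proof (rule exchange_average[OF finS k(2)])
    fix T i j assume T: "T \<subseteq> S" "card T = k" "i \<in> T" "j \<in> S - T"
    then have ij: "i \<in> {1..n}" "j \<in> {1..n}" "i \<noteq> j" using S by auto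
    show "ennreal (a\<^sup>2 / 8) \<le> (\<integral>\<^sup>+y. ennreal ((est y i - a)\<^sup>2) \<partial>gauss_prod {1..n} \<sigma> (spike T))
      + ennreal (real (card S - k) / real k) *
        (\<integral>\<^sup>+y. ennreal ((est y i)\<^sup>2) \<partial>gauss_prod {1..n} \<sigma> (spike (insert j (T - {i}))))"
    proof (rule two_point_bound[where j = j])
      show "(\<lambda>y. est y i) \<in> borel_measurable (Pi\<^sub>M {1..n} (\<lambda>_. borel))"
        using ij(1) by measurable
    qed (use T ij \<sigma> a R in \<open>auto simp: spike_def\<close>)
  next
    fix T assume T: "T \<subseteq> S" "card T = k"
    have "(\<Sum>i\<in>T. \<integral>\<^sup>+y. ennreal ((est y i - a)\<^sup>2) \<partial>gauss_prod {1..n} \<sigma> (spike T))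
        + (\<Sum>i\<in>S - T. \<integral>\<^sup>+y. ennreal ((est y i)\<^sup>2) \<partial>gauss_prod {1..n} \<sigma> (spike T))
      = (\<Sum>i\<in>T. \<integral>\<^sup>+y. ennreal ((est y i - spike T i)\<^sup>2) \<partial>gauss_prod {1..n} \<sigma> (spike T))
        + (\<Sum>i\<in>S - T. \<integral>\<^sup>+y. ennreal ((est y i - spike T i)\<^sup>2) \<partial>gauss_prod {1..n} \<sigma> (spike T))"
      using T S by (intro arg_cong2[where f = "(+)"] sum.cong) (auto simp: spike_def)
    also have "\<dots> = (\<Sum>i\<in>S. \<integral>\<^sup>+y. ennreal ((est y i - spike T i)\<^sup>2) \<partial>gauss_prod {1..n} \<sigma> (spike T))"
      by (subst sum.subset_diff[OF T(1) finS]) (rule add.commute)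
    \<comment> \<open>The losses at coordinates outside \<open>S\<close> are nonnegative and are
      dropped.\<close>
    also have "\<dots> \<le> of_nat n * risk n \<sigma> est (spike T)"
      unfolding risk_eq_sum[OF \<sigma> n est] using S by (intro sum_mono2) auto
    also have "risk n \<sigma> est (spike T) \<le> X"
      unfolding X_def spike_def by (intro SUP_upper \<Theta> T)
    finally show "(\<Sum>i\<in>T. \<integral>\<^sup>+y. ennreal ((est y i - a)\<^sup>2) \<partial>gauss_prod {1..n} \<sigma> (spike T))
        + (\<Sum>i\<in>S - T. \<integral>\<^sup>+y. ennreal ((est y i)\<^sup>2) \<partial>gauss_prod {1..n} \<sigma> (spike T)) \<le> of_nat n * X"
      by (simp add: mult_left_mono)
  qed
  also have "of_nat k * ennreal (a\<^sup>2 / 8) = of_nat n * ennreal (real k * a\<^sup>2 / (8 * real n))"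
    using n by (simp add: ennreal_of_nat_eq_real_of_nat flip: ennreal_mult')
  finally show "ennreal (real k * a\<^sup>2 / (8 * real n)) \<le> (SUP \<theta>0\<in>\<Theta>. risk n \<sigma> est \<theta>0)"
    using n by (simp add: X_def ennreal_mult_le_mult_iff)
qed

text \<open>Spikes on vertices of degree at most 2 stay in the class. A third of the vertices
  qualify, so candidate positions outnumber the spikes by a factor of order at least
  \<open>n / s\<close>, and its logarithm enters through \<open>a\<^sup>2\<close>.\<close>

lemma tree_minimax_bound:
  fixes s \<sigma> :: real
  assumes G: "simple_graph {1..n} E" "\<nexists>p. graph_cycle E p" and ori: "orientation E ep em"
    and s: "2 \<le> s" and \<sigma>: "0 < \<sigma>" and ns: "9 < real n / s"
  shows "ennreal (1/64 * \<sigma>\<^sup>2 * (s / real n) * ln (real n / s)) \<le> minimax_risk n \<sigma> (BD n E ep em s)"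
proof -
  define S where "S = {v\<in>{1..n}. card {e\<in>E. v \<in> e} \<le> 2}"
  \<comment> \<open>Each spike may change two edges, hence the half. The condition
    \<open>2 \<le> s\<close> makes \<open>k\<close> positive, and rounding down then costs at most
    another factor 2.\<close>
  define k where "k = nat \<lfloor>s / 2\<rfloor>"
  define x where "x = real n / s"
  \<comment> \<open>Chosen so that \<open>exp (a\<^sup>2 / \<sigma>\<^sup>2) = sqrt x\<close>;
    taking the square root of \<open>x\<close> leaves room for the constants lost in
    \<open>S\<close> and \<open>k\<close>.\<close>
  define a where "a = \<sigma> * sqrt (ln x / 2)"
  have x: "9 < x" using ns by (simp add: x_def)
  have nx: "real n = x * s" using s by (simp add: x_def)
  have k: "1 \<le> k" "real k \<le> s / 2" "s / 4 \<le> real k"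
  proof -
    have "1 \<le> \<lfloor>s / 2\<rfloor>" using s by (simp add: le_floor_iff)
    then show "1 \<le> k" "real k \<le> s / 2" "s / 4 \<le> real k"
      unfolding k_def by linarith+
  qed
  have "n \<le> 3 * card S"
    using acyclic_many_low_degree[OF G] by (simp add: S_def)
  then have S3: "x * s / 3 \<le> real (card S)" by (simp flip: nx)
  have "9 * s \<le> x * s"
    using x s by (intro mult_right_mono) auto
  with k(2) S3 s have kS: "k < card S" by linarith
  \<comment> \<open>Here the threshold 9 enters, as \<open>3 \<le> sqrt x\<close>. It bounds
    \<open>sqrt x * k\<close> by \<open>x * s / 6\<close>, half of the lower bound for
    \<open>card S\<close>.\<close>
  have x3: "3 * sqrt x \<le> x"
    using x real_le_rsqrt[of 3 x] mult_right_mono[of 3 "sqrt x" "sqrt x"] by simp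
  have a2: "a\<^sup>2 = \<sigma>\<^sup>2 * ln x / 2"
    using x by (simp add: a_def power_mult_distrib)
  have "exp (a\<^sup>2 / \<sigma>\<^sup>2) = sqrt x"
    using x \<sigma> by (simp add: a2 powr_half_sqrt[symmetric] powr_def)
  also have "sqrt x \<le> real (card S - k) / real k"
  proof -
    have "sqrt x * real k \<le> sqrt x * (s / 2)"
      using k x by (intro mult_left_mono) auto
    also have "\<dots> \<le> x * s / 6"
      using mult_right_mono[OF x3, of "s / 6"] s by simp
    \<comment> \<open>The other half pays for the at most \<open>s / 2\<close> vertices taken up by
      the support.\<close>
    also have "\<dots> \<le> x * s / 3 - s / 2"
      using \<open>9 * s \<le> x * s\<close> s by linarith
    also have "\<dots> \<le> real (card S - k)"
      using S3 k(2) kS by (simp add: of_nat_diff)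
    finally show ?thesis
      using k(1) by (simp add: pos_le_divide_eq)
  qed
  finally have R: "exp (a\<^sup>2 / \<sigma>\<^sup>2) \<le> real (card S - k) / real k" .
  \<comment> \<open>The constant collects 1/4 from \<open>k\<close>, 1/2 from
    \<open>a\<^sup>2\<close> and 1/8 from \<open>sparse_minimax_bound\<close>.\<close>
  have "1/64 * \<sigma>\<^sup>2 * (s / real n) * ln x = (s / 4) * a\<^sup>2 / (8 * real n)"
    by (simp add: a2)
  also have "\<dots> \<le> real k * a\<^sup>2 / (8 * real n)"
    using k by (intro divide_right_mono mult_right_mono) auto
  finally have "ennreal (1/64 * \<sigma>\<^sup>2 * (s / real n) * ln x) \<le> ennreal (real k * a\<^sup>2 / (8 * real n))"
    by (rule ennreal_leI)
  also have "\<dots> \<le> minimax_risk n \<sigma> (BD n E ep em s)"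
  proof (rule sparse_minimax_bound[OF \<sigma> _ _ kS _ R])
    fix T assume T: "T \<subseteq> S" "card T = k"
    have "grad_l0 E ep em (\<lambda>i\<in>{1..n}. if i \<in> T then a else 0) \<le> real (2 * card T)"
      using T by (intro grad_l0_sparse[OF G(1) ori]) (auto simp: S_def finite_subset)
    also have "\<dots> \<le> s" using k(2) T(2) by simp
    finally show "(\<lambda>i\<in>{1..n}. if i \<in> T then a else 0) \<in> BD n E ep em s"
      by (auto simp: BD_def)
  qed (use x \<sigma> k in \<open>auto simp: S_def a_def\<close>)
  finally show ?thesis by (simp add: x_def)
qed

theorem theorem7:
  shows "\<exists>N C :: real. N > 0 \<and> C > 0 \<and>
    (\<forall>(n::nat) (E :: nat set set) (ep :: nat set \<Rightarrow> nat) (em :: nat set \<Rightarrow> nat) (s::real) (\<sigma>::real).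
       is_tree {1..n} E \<longrightarrow> orientation E ep em \<longrightarrow> s \<ge> 2 \<longrightarrow> \<sigma> > 0 \<longrightarrow> real n / s > N \<longrightarrow>
       minimax_risk n \<sigma> (BD n E ep em s) \<ge> ennreal (C * \<sigma>\<^sup>2 * (s / real n) * ln (real n / s)))"
  by (intro exI[of _ 9] exI[of _ "1/64"] conjI allI impI tree_minimax_bound)
     (auto simp: is_tree_def)

end
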